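(* Let $A=RB:I\to\mathbb{R}^{3\times6}$ be smooth on an open interval $I$, with columns linearly independent over $\mathbb{R}$ (as functions on $I$), where $R(t)\in SO(3)$ and $$B=\begin{pmatrix}b_{11}&b_{12}&b_{13}&\ell_2b_{12}&b_{13}/(\ell_1\ell_2)&\ell_1b_{11}\\0&b_{22}&b_{23}&\ell_2b_{22}&b_{23}/(\ell_1\ell_2)&0\\0&0&1/(b_{11}b_{22})&0&1/(\ell_1\ell_2b_{11}b_{22})&0\end{pmatrix}$$ with $b_{11},b_{22},\ell_1,\ell_2$ nowhere zero. Suppose that $$Q_{12},Q_{13},Q_{15},Q_{16},Q_{23},Q_{24},Q_{26},Q_{34},Q_{35},Q_{45},Q_{46},Q_{56}$$ are constant, $Q_{ij}=c_{ij}$, and that there is no algebraic relation between $\ell_1$ and $\ell_2$ (no nonzero real polynomial $P$ with $P(\ell_1,\ell_2)\equiv0$ on $I$). Then $R$ is constant and $$\ell_1'=-\frac{c_{16}}{b_{11}^2},\qquad \ell_2'=-\frac{c_{24}}{b_{22}^2},\qquad c_{35}\,\ell_1^2\ell_2^2b_{11}^4b_{22}^4+c_{16}b_{22}^2\ell_2+c_{24}b_{11}^2\ell_1=0,\qquad b_{12}=b_{13}=b_{23}=0 .$$ Conversely, if $R$ is constant and these equations hold for some constants $c_{16},c_{24},c_{35}$, then all the $Q_{ij}$ listed above are constant.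
   Context: For $A(t)\in\mathbb{R}^{3\times m}$ with columns $A_i$, $Q_{ij}=\langle A_i',A_j\rangle-\langle A_j',A_i\rangle$, $'=d/dt$. Origin: $\varphi(z,t)=A(t)v(z)$ is sought as a solution of the 3D incompressible Euler equations in Lagrangian form, with $v=(z_1,z_2,z_3,f_1(z_1),f_2(z_2),f_3(z_3))$, i.e. spatial constraints $dv^1\wedge dv^4=dv^2\wedge dv^5=dv^3\wedge dv^6=0$ (hyperbolic case, $m=6$). The matrix $B$ above is the $QR$ form of a time component whose minors $p_{ijk}=\det(A_i,A_j,A_k)$ satisfy the normalized conditions $p_{123}=p_{456}=1$, $p_{126}=p_{135}=p_{156}=p_{234}=p_{246}=p_{345}=0$, where one has $A_6=\ell_1A_1$, $A_4=\ell_2A_2$, $A_5=A_3/(\ell_1\ell_2)$. Solutions with columns of $A$ linearly dependent over $\mathbb{R}$ are called reducible and discarded.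
   Formalization: The factor R is additionally assumed continuous on I; without this, discontinuous sign changes R→RD, B→DB with D=diag(d1,d2,d1d2), d1,d2=±1, leave A and the form of B intact but make R non-constant. *)

theory Defs
  imports "HOL-Analysis.Analysis" "HOL-Computational_Algebra.Polynomial"
begin

(* C^infinity on an open set of reals: every iterated derivative exists and is differentiable. *)
definition smooth_on :: "real set \<Rightarrow> (real \<Rightarrow> 'a::real_normed_vector) \<Rightarrow> bool" where
  "smooth_on I f \<longleftrightarrow>
     (\<forall>n. ((\<lambda>g t. vector_derivative g (at t)) ^^ n) f differentiable_on I)"

definition Q :: "(real \<Rightarrow> real^'m^3) \<Rightarrow> 'm \<Rightarrow> 'm \<Rightarrow> real \<Rightarrow> real" where
  "Q A i j t =
     vector_derivative (\<lambda>s. column i (A s)) (at t) \<bullet> column j (A t)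
   - vector_derivative (\<lambda>s. column j (A s)) (at t) \<bullet> column i (A t)"

(* The coefficients are real constants; the columns are functions of t. *)
definition columns_independent_on :: "real set \<Rightarrow> (real \<Rightarrow> real^'m^3) \<Rightarrow> bool" where
  "columns_independent_on I A \<longleftrightarrow>
     (\<forall>a :: 'm \<Rightarrow> real.
        (\<forall>t\<in>I. (\<Sum>j\<in>UNIV. a j *\<^sub>R column j (A t)) = 0) \<longrightarrow> (\<forall>j. a j = 0))"

(* P ranges over R[x][y]: "poly P [:y:]" substitutes for the outer variable, giving a
   polynomial in x, which is then evaluated. *)
definition algebraically_related_on ::
  "real set \<Rightarrow> (real \<Rightarrow> real) \<Rightarrow> (real \<Rightarrow> real) \<Rightarrow> bool" where
  "algebraically_related_on I x y \<longleftrightarrow>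
     (\<exists>P :: real poly poly. P \<noteq> 0 \<and> (\<forall>t\<in>I. poly (poly P [:y t:]) (x t) = 0))"

(* In the index type 6 the numeral 6 denotes the same element as 0; the rows below are indexed
   1, ..., 6 in the order written (see B_matrix_columns). *)
definition B_matrix ::
  "real \<Rightarrow> real \<Rightarrow> real \<Rightarrow> real \<Rightarrow> real \<Rightarrow> real \<Rightarrow> real \<Rightarrow> real^6^3" where
  "B_matrix b11 b12 b13 b22 b23 l1 l2 = vector
     [vector [b11, b12, b13, l2 * b12, b13 / (l1 * l2), l1 * b11],
      vector [0, b22, b23, l2 * b22, b23 / (l1 * l2), 0],
      vector [0, 0, 1 / (b11 * b22), 0, 1 / (l1 * l2 * b11 * b22), 0]]"

definition listed_pairs :: "(6 \<times> 6) set" where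
  "listed_pairs =
     {(1,2), (1,3), (1,5), (1,6), (2,3), (2,4), (2,6), (3,4), (3,5), (4,5), (4,6), (5,6)}"

lemma vector_6:
  "(vector [a,b,c,d,e,f] :: ('a::zero)^6) $ 1 = a"
  "(vector [a,b,c,d,e,f] :: ('a::zero)^6) $ 2 = b"
  "(vector [a,b,c,d,e,f] :: ('a::zero)^6) $ 3 = c"
  "(vector [a,b,c,d,e,f] :: ('a::zero)^6) $ 4 = d"
  "(vector [a,b,c,d,e,f] :: ('a::zero)^6) $ 5 = e"
  "(vector [a,b,c,d,e,f] :: ('a::zero)^6) $ 6 = f"
  unfolding vector_def by simp_all

lemma B_matrix_columns:
  "column 1 (B_matrix b11 b12 b13 b22 b23 l1 l2) = vector [b11, 0, 0]"
  "column 2 (B_matrix b11 b12 b13 b22 b23 l1 l2) = vector [b12, b22, 0]"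
  "column 3 (B_matrix b11 b12 b13 b22 b23 l1 l2) = vector [b13, b23, 1 / (b11 * b22)]"
  "column 4 (B_matrix b11 b12 b13 b22 b23 l1 l2) = vector [l2 * b12, l2 * b22, 0]"
  "column 5 (B_matrix b11 b12 b13 b22 b23 l1 l2) =
     vector [b13 / (l1 * l2), b23 / (l1 * l2), 1 / (l1 * l2 * b11 * b22)]"
  "column 6 (B_matrix b11 b12 b13 b22 b23 l1 l2) = vector [l1 * b11, 0, 0]"
  unfolding B_matrix_def column_def vec_eq_iff forall_3
  by (simp_all only: vec_lambda_beta vector_3 vector_6 simp_thms)

end

theory Submission
  imports Defs
begin

text \<open>
  Write \<open>a1, a2, a3\<close> for the first three columns of \<open>A\<close>. The other three are the multiples
  \<open>l2 a2\<close>, \<open>l3 a3\<close>, \<open>l1 a1\<close>, where \<open>l3 = 1 / (l1 l2)\<close>, and the cyclic shift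
  \<open>1 \<rightarrow> 2 \<rightarrow> 3 \<rightarrow> 1\<close> of columns and multipliers permutes the twelve brackets \<open>Q\<close> up to sign.
  For a pair of columns \<open>u, v\<close> with multipliers \<open>x, y\<close> and \<open>g = u \<bullet> v\<close>, the three brackets of \<open>(u, v)\<close>, \<open>(v, x u)\<close>, \<open>(y v, x u)\<close> are constants
  \<open>a, b, c\<close>, which by the Leibniz rule amounts to
  \<open>x' g = - b - a x\<close> and \<open>x y' g = c - b y\<close>. Eliminating \<open>g\<close> leaves the separable equation
  \<open>(b + a x) x y' = (b y - c) x'\<close>, which has the first integral
  \<open>(b y - c) (b + a x) / x\<close> if \<open>b \<noteq> 0\<close> and \<open>a y - c / x\<close> if \<open>b = 0\<close>. Constancy of either one is a
  bilinear relation \<open>p x y + q x + r y + s = 0\<close> on the whole interval, hence a polynomial relation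
  between \<open>l1\<close> and \<open>l2\<close>. Algebraic independence therefore forces \<open>a = b = c = 0\<close>, so that
  \<open>x' g = y' g = 0\<close> (lemma \<open>multiplier_pair\<close>).

  The bracket of \<open>u\<close> and \<open>x u\<close> is \<open>- x' (u \<bullet> u)\<close>. Since it is constant, \<open>x'\<close> vanishes everywhere or
  nowhere (lemma \<open>multiplier_constant_or_regular\<close>), and a constant multiplier is an algebraic
  relation. So \<open>l1'\<close> and \<open>l2'\<close> have no zeros, all three inner products \<open>g\<close> vanish, and \<open>B\<close> is
  diagonal in its first three columns. Moreover the brackets of the \<open>ai\<close> with each other are zero;
  together with orthogonality this makes \<open>ai'\<close> orthogonal to the other two columns, hence parallel
  to \<open>ai\<close>. The direction of \<open>ai\<close> then stays on one line, and by continuity \<open>R\<close> is constant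
  (lemma \<open>direction_constant\<close>). The differential equations for \<open>l1\<close> and \<open>l2\<close> are the values of the
  brackets \<open>(1, 6)\<close> and \<open>(2, 4)\<close>, and the algebraic equation is that of \<open>(3, 5)\<close> with \<open>l3'\<close>
  expressed by \<open>l1'\<close> and \<open>l2'\<close>.

  For the converse, a bracket of two columns moving along fixed orthogonal lines is zero, and the
  same three formulas give the remaining brackets.
\<close>

section \<open>The bracket of two curves\<close>

text \<open>
  This is \<open>Q\<close> for curves that need not be columns of a matrix, which makes it possible to
  rescale them.
\<close>

definition skew :: "(real \<Rightarrow> 'a::real_inner) \<Rightarrow> (real \<Rightarrow> 'a) \<Rightarrow> real \<Rightarrow> real" where
  "skew u v t = vector_derivative u (at t) \<bullet> v t - vector_derivative v (at t) \<bullet> u t"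

lemma Q_eq_skew: "Q A i j t = skew (\<lambda>s. column i (A s)) (\<lambda>s. column j (A s)) t"
  by (simp add: Q_def skew_def)

lemma skew_swap: "skew v u t = - skew u v t"
  by (simp add: skew_def)

lemma skew_self [simp]: "skew u u t = 0"
  by (simp add: skew_def)

lemma skew_cong:
  assumes "open I" "t \<in> I" "\<And>s. s \<in> I \<Longrightarrow> u s = u' s" "\<And>s. s \<in> I \<Longrightarrow> v s = v' s"
  shows "skew u v t = skew u' v' t"
proof -
  have "eventually (\<lambda>s. s \<in> I) (nhds t)"
    using assms(1,2) by (rule eventually_nhds_in_open)
  then have "eventually (\<lambda>s. u s = u' s) (nhds t)" "eventually (\<lambda>s. v s = v' s) (nhds t)"
    using assms(3,4) by (auto elim: eventually_mono)
  then show ?thesis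
    using assms unfolding skew_def by (simp add: vector_derivative_cong_eq)
qed

lemma skew_scaleR:
  assumes u: "(u has_vector_derivative u') (at t)"
    and v: "(v has_vector_derivative v') (at t)"
    and f: "(f has_real_derivative f') (at t)"
    and h: "(h has_real_derivative h') (at t)"
  shows "skew (\<lambda>s. f s *\<^sub>R u s) (\<lambda>s. h s *\<^sub>R v s) t
       = f t * h t * skew u v t + (f' * h t - f t * h') * (u t \<bullet> v t)"
proof -
  have 1: "vector_derivative (\<lambda>s. f s *\<^sub>R u s) (at t) = f t *\<^sub>R u' + f' *\<^sub>R u t"
    using has_vector_derivative_scaleR[OF f u] by (rule vector_derivative_at)
  have 2: "vector_derivative (\<lambda>s. h s *\<^sub>R v s) (at t) = h t *\<^sub>R v' + h' *\<^sub>R v t"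
    using has_vector_derivative_scaleR[OF h v] by (rule vector_derivative_at)
  have 3: "vector_derivative u (at t) = u'" "vector_derivative v (at t) = v'"
    using u v by (auto intro: vector_derivative_at)
  show ?thesis
    unfolding skew_def 1 2 3 by (simp add: algebra_simps inner_commute)
qed

lemma skew_scaleR_right:
  assumes u: "(u has_vector_derivative u') (at t)"
    and v: "(v has_vector_derivative v') (at t)"
    and h: "(h has_real_derivative h') (at t)"
  shows "skew u (\<lambda>s. h s *\<^sub>R v s) t = h t * skew u v t - h' * (u t \<bullet> v t)"
  using skew_scaleR[OF u v DERIV_const[of 1] h] by simp

lemma has_real_derivative_inner:
  assumes "(f has_vector_derivative f') (at t)" "(g has_vector_derivative g') (at t)"
  shows "((\<lambda>s. f s \<bullet> g s) has_real_derivative (f t \<bullet> g' + f' \<bullet> g t)) (at t)"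
  unfolding has_field_derivative_def
  by (rule has_derivative_eq_rhs[OF has_derivative_inner[OF assms[unfolded has_vector_derivative_def]]])
     (auto simp: fun_eq_iff algebra_simps)

text \<open>
  Only the columns are known to be differentiable; a multiplier inherits this because it is
  the quotient \<open>(w \<bullet> u) / (u \<bullet> u)\<close>.
\<close>

lemma multiplier_differentiable:
  fixes u w :: "real \<Rightarrow> 'a::real_inner"
  assumes I: "open I" "t \<in> I"
    and u: "(u has_vector_derivative u') (at t)"
    and w: "(w has_vector_derivative w') (at t)"
    and eq: "\<And>s. s \<in> I \<Longrightarrow> w s = x s *\<^sub>R u s" and nz: "\<And>s. s \<in> I \<Longrightarrow> u s \<noteq> 0"
  obtains x' where "(x has_real_derivative x') (at t)"
proof -
  note ip = has_real_derivative_inner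
  have "u t \<bullet> u t \<noteq> 0" using nz I by simp
  from DERIV_divide[OF ip[OF w u] ip[OF u u] this]
  have "((\<lambda>s. (w s \<bullet> u s) / (u s \<bullet> u s)) has_real_derivative
     ((w t \<bullet> u' + w' \<bullet> u t) * (u t \<bullet> u t) - w t \<bullet> u t * (u t \<bullet> u' + u' \<bullet> u t))
        / (u t \<bullet> u t * (u t \<bullet> u t))) (at t)" .
  then have "(x has_real_derivative
     ((w t \<bullet> u' + w' \<bullet> u t) * (u t \<bullet> u t) - w t \<bullet> u t * (u t \<bullet> u' + u' \<bullet> u t))
        / (u t \<bullet> u t * (u t \<bullet> u t))) (at t)"
    by (rule has_field_derivative_transform_within_open[OF _ I]) (simp add: eq nz)
  then show thesis by (rule that)
qed

section \<open>Multipliers satisfying no bilinear relation\<close>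

text \<open>
  The hypotheses \<open>b\<close> and \<open>c\<close> are two linear equations for the function \<open>g\<close>, and their compatibility
  is a differential equation for \<open>x\<close> and \<open>y\<close> alone. It has a rational first integral, whose
  constancy is a bilinear relation with a nonzero coefficient unless \<open>a = b = c = 0\<close>. The integral is
  constant on the whole interval, including the places where \<open>g\<close> vanishes, so a single
  relation holds throughout.
\<close>

lemma multiplier_ode_relation:
  fixes x y x' y' g :: "real \<Rightarrow> real"
  assumes I: "open I" "is_interval I"
    and dx: "\<And>t. t \<in> I \<Longrightarrow> (x has_real_derivative x' t) (at t)"
    and dy: "\<And>t. t \<in> I \<Longrightarrow> (y has_real_derivative y' t) (at t)"
    and x0: "\<And>t. t \<in> I \<Longrightarrow> x t \<noteq> 0"
    and b: "\<And>t. t \<in> I \<Longrightarrow> - x t * a - x' t * g t = b"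
    and c: "\<And>t. t \<in> I \<Longrightarrow> - x t * y t * a + (y' t * x t - y t * x' t) * g t = c"
    and indep: "\<And>p q r s. \<forall>t\<in>I. p * x t * y t + q * x t + r * y t + s = 0
        \<Longrightarrow> p = 0 \<and> q = 0 \<and> r = 0 \<and> s = 0"
  shows "a = 0 \<and> b = 0 \<and> c = 0"
proof -
  have xg: "x' t * g t = - b - x t * a" if "t \<in> I" for t using b[OF that] by simp
  have yg: "y' t * x t * g t = c - y t * b" if "t \<in> I" for t
  proof -
    have "y' t * x t * g t = (c + x t * y t * a) + y t * (x' t * g t)"
      using c[OF that] by (simp add: algebra_simps)
    also have "\<dots> = c - y t * b"
      unfolding xg[OF that] by (simp add: algebra_simps)
    finally show ?thesis .
  qed
  (* Where g vanishes, both sides vanish, so the equation needs no division by g. *)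
  have ode: "(b + x t * a) * x t * y' t = (y t * b - c) * x' t" if "t \<in> I" for t
  proof (cases "g t = 0")
    case True
    then show ?thesis using xg[OF that] yg[OF that] by algebra
  next
    case False
    have "g t * ((b + x t * a) * x t * y' t) = g t * ((y t * b - c) * x' t)"
      using xg[OF that] yg[OF that] by algebra
    then show ?thesis using False by simp
  qed
  have const: "\<exists>K. \<forall>t\<in>I. F t = K" if "\<And>t. t \<in> I \<Longrightarrow> (F has_real_derivative 0) (at t)" for F
  proof -
    have "convex I" using I by (simp add: is_interval_convex)
    then have "\<exists>K. \<forall>t\<in>I. F t = K"
      by (rule has_field_derivative_zero_constant)
         (use that in \<open>auto intro: has_field_derivative_at_within\<close>)
    then show ?thesis .
  qed
  show ?thesis
  proof (cases "b = 0")
    case True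
    (* For b = 0 the separated equation is a y' = - c x' / x^2. *)
    have "((\<lambda>t. a * y t - c / x t) has_real_derivative 0) (at t)" if "t \<in> I" for t
    proof -
      have "a * x t * x t * y' t + c * x' t = 0"
        using ode[OF that] True by algebra
      then have "y' t * a + c * x' t / (x t * x t) = 0"
        using x0[OF that] by (simp add: field_simps)
      then show ?thesis
        by (auto intro!: derivative_eq_intros dx[OF that] dy[OF that] x0[OF that])
    qed
    from const[OF this] obtain K where K: "\<And>t. t \<in> I \<Longrightarrow> a * y t - c / x t = K" by blast
    have "a * x t * y t + (- K) * x t + 0 * y t + (- c) = 0" if "t \<in> I" for t
      using K[OF that] x0[OF that] by (simp add: field_simps)
    then show ?thesis
      using indep[of a "- K" 0 "- c"] True by simp
  next
    case False
    (* Separating variables and exponentiating: log (b y - c) + log ((b + a x) / x) is constant. *)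
    have "((\<lambda>t. (y t * b - c) * (b / x t + a)) has_real_derivative 0) (at t)" if "t \<in> I" for t
    proof -
      have "y' t * b * (b + x t * a) * x t - (y t * b - c) * (b * x' t) = 0"
        using ode[OF that] by algebra
      moreover have "y' t * b * (b / x t + a) + (y t * b - c) * (- (b * x' t) / (x t * x t))
          = (y' t * b * (b + x t * a) * x t - (y t * b - c) * (b * x' t)) / (x t * x t)"
        using x0[OF that] by (simp add: divide_simps)
      ultimately have "y' t * b * (b / x t + a) + (y t * b - c) * (- (b * x' t) / (x t * x t)) = 0"
        by simp
      then show ?thesis
        by (auto intro!: derivative_eq_intros dx[OF that] dy[OF that] x0[OF that])
    qed
    from const[OF this] obtain K where
      K: "\<And>t. t \<in> I \<Longrightarrow> (y t * b - c) * (b / x t + a) = K" by blast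
    have "(a * b) * x t * y t + (- (a * c + K)) * x t + (b * b) * y t + (- (b * c)) = 0"
      if "t \<in> I" for t
    proof -
      have "(y t * b - c) * (b + a * x t) = K * x t"
        using K[OF that] x0[OF that] by (simp add: field_simps)
      then show ?thesis by algebra
    qed
    then show ?thesis
      using indep[of "a * b" "- (a * c + K)" "b * b" "- (b * c)"] False by simp
  qed
qed

text \<open>
  This form applies to each of the column pairs \<open>(1, 2)\<close>, \<open>(2, 3)\<close>, \<open>(3, 1)\<close> by cyclic symmetry.
\<close>

lemma multiplier_pair:
  fixes u v :: "real \<Rightarrow> 'a::real_inner"
  assumes I: "open I" "is_interval I"
    and u: "\<And>t. t \<in> I \<Longrightarrow> (u has_vector_derivative u' t) (at t)"
    and v: "\<And>t. t \<in> I \<Longrightarrow> (v has_vector_derivative v' t) (at t)"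
    and dx: "\<And>t. t \<in> I \<Longrightarrow> (x has_real_derivative x' t) (at t)"
    and dy: "\<And>t. t \<in> I \<Longrightarrow> (y has_real_derivative y' t) (at t)"
    and x0: "\<And>t. t \<in> I \<Longrightarrow> x t \<noteq> 0"
    and a: "\<And>t. t \<in> I \<Longrightarrow> skew u v t = a"
    and b: "\<And>t. t \<in> I \<Longrightarrow> skew v (\<lambda>s. x s *\<^sub>R u s) t = b"
    and c: "\<And>t. t \<in> I \<Longrightarrow> skew (\<lambda>s. y s *\<^sub>R v s) (\<lambda>s. x s *\<^sub>R u s) t = c"
    and indep: "\<And>p q r s. \<forall>t\<in>I. p * x t * y t + q * x t + r * y t + s = 0
        \<Longrightarrow> p = 0 \<and> q = 0 \<and> r = 0 \<and> s = 0"
  shows "a = 0 \<and> (\<forall>t\<in>I. x' t * (u t \<bullet> v t) = 0 \<and> y' t * (u t \<bullet> v t) = 0)"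
proof -
  have b': "- x t * a - x' t * (u t \<bullet> v t) = b" if "t \<in> I" for t
    using skew_scaleR_right[OF v[OF that] u[OF that] dx[OF that]] a[OF that] b[OF that]
    by (simp add: skew_swap[of v u] inner_commute)
  have c': "- x t * y t * a + (y' t * x t - y t * x' t) * (u t \<bullet> v t) = c" if "t \<in> I" for t
    using skew_scaleR[OF v[OF that] u[OF that] dy[OF that] dx[OF that]] a[OF that] c[OF that]
    by (simp add: skew_swap[of v u] inner_commute mult.commute)
  have z: "a = 0 \<and> b = 0 \<and> c = 0"
    by (rule multiplier_ode_relation[OF I dx dy x0 b' c' indep])
  have 1: "x' t * (u t \<bullet> v t) = 0" if "t \<in> I" for t
    using b'[OF that] z by simp
  have "y' t * (u t \<bullet> v t) = 0" if "t \<in> I" for t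
  proof -
    have "x t * (y' t * (u t \<bullet> v t)) = 0"
      using c'[OF that] 1[OF that] z by algebra
    then show ?thesis using x0[OF that] by simp
  qed
  with 1 z show ?thesis by simp
qed

text \<open>
  The constant \<open>c\<close> equals \<open>- x' (u \<bullet> u)\<close>, so a single zero of \<open>x'\<close> makes it zero and then \<open>x'\<close> vanishes
  identically.
\<close>

lemma multiplier_constant_or_regular:
  fixes u :: "real \<Rightarrow> 'a::real_inner"
  assumes I: "open I" "is_interval I"
    and u: "\<And>t. t \<in> I \<Longrightarrow> (u has_vector_derivative u' t) (at t)"
    and dx: "\<And>t. t \<in> I \<Longrightarrow> (x has_real_derivative x' t) (at t)"
    and u0: "\<And>t. t \<in> I \<Longrightarrow> u t \<noteq> 0"
    and c: "\<And>t. t \<in> I \<Longrightarrow> skew u (\<lambda>s. x s *\<^sub>R u s) t = c"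
  obtains k where "\<And>t. t \<in> I \<Longrightarrow> x t = k" | "\<And>t. t \<in> I \<Longrightarrow> x' t \<noteq> 0"
proof -
  have eq: "x' t * (u t \<bullet> u t) = - c" if "t \<in> I" for t
    using skew_scaleR_right[OF u[OF that] u[OF that] dx[OF that]] c[OF that] by simp
  show thesis
  proof (cases "c = 0")
    case True
    have "(x has_real_derivative 0) (at t within I)" if "t \<in> I" for t
    proof -
      have "x' t = 0" using eq[OF that] u0[OF that] True by simp
      then show ?thesis using dx[OF that] by (simp add: has_field_derivative_at_within)
    qed
    then have "\<exists>k. \<forall>t\<in>I. x t = k"
      using I by (intro has_field_derivative_zero_constant) (auto simp: is_interval_convex)
    then show thesis using that(1) by blast
  next
    case False
    then have "x' t \<noteq> 0" if "t \<in> I" for t using eq[OF that] by auto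
    then show thesis using that(2) by blast
  qed
qed

lemma algebraically_related_onI:
  assumes "P \<noteq> 0" "\<And>t. t \<in> I \<Longrightarrow> poly (poly P [:y t:]) (x t) = 0"
  shows "algebraically_related_on I x y"
  using assms unfolding algebraically_related_on_def by blast

lemma algebraically_related_if_constant:
  assumes "\<And>t. t \<in> I \<Longrightarrow> x t = k"
  shows "algebraically_related_on I x y" "algebraically_related_on I y x"
  by (rule algebraically_related_onI[of "[:[:- k, 1:]:]"]; simp add: assms)
     (rule algebraically_related_onI[of "[:[:- k:], 1:]"]; simp add: assms)

text \<open>
  The pairs \<open>(y, z)\<close> and \<open>(z, x)\<close> with \<open>z = 1 / (x y)\<close> are as independent as \<open>(x, y)\<close>: multiplying
  by \<open>x y\<close> turns a bilinear relation for them into a polynomial one for \<open>x\<close> and \<open>y\<close>, and the four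
  coefficients remain attached to four different monomials.
\<close>

lemma no_bilinear_relation:
  assumes indep: "\<not> algebraically_related_on I x y"
    and xy: "\<And>t. t \<in> I \<Longrightarrow> x t \<noteq> 0 \<and> y t \<noteq> 0"
    and z: "z = (\<lambda>t. 1 / (x t * y t))"
  shows "\<forall>t\<in>I. p * x t * y t + q * x t + r * y t + s = 0 \<Longrightarrow> p = 0 \<and> q = 0 \<and> r = 0 \<and> s = 0"
    and "\<forall>t\<in>I. p * y t * z t + q * y t + r * z t + s = 0 \<Longrightarrow> p = 0 \<and> q = 0 \<and> r = 0 \<and> s = 0"
    and "\<forall>t\<in>I. p * z t * x t + q * z t + r * x t + s = 0 \<Longrightarrow> p = 0 \<and> q = 0 \<and> r = 0 \<and> s = 0"
proof -
  assume h: "\<forall>t\<in>I. p * x t * y t + q * x t + r * y t + s = 0"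
  then have "poly (poly [:[:s, q:], [:r, p:]:] [:y t:]) (x t) = 0" if "t \<in> I" for t
    using that by (auto simp: algebra_simps)
  then have "[:[:s, q:], [:r, p:]:] = 0"
    using algebraically_related_onI indep by blast
  then show "p = 0 \<and> q = 0 \<and> r = 0 \<and> s = 0" by simp
next
  assume h: "\<forall>t\<in>I. p * y t * z t + q * y t + r * z t + s = 0"
  have "r + p * y t + s * x t * y t + q * x t * y t * y t = 0" if "t \<in> I" for t
    using bspec[OF h that] xy[OF that] by (simp add: z field_simps)
  then have "poly (poly [:[:r:], [:p, s:], [:0, q:]:] [:y t:]) (x t) = 0" if "t \<in> I" for t
    using that by (auto simp: algebra_simps)
  then have "[:[:r:], [:p, s:], [:0, q:]:] = 0"
    using algebraically_related_onI indep by blast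
  then show "p = 0 \<and> q = 0 \<and> r = 0 \<and> s = 0" by simp
next
  assume h: "\<forall>t\<in>I. p * z t * x t + q * z t + r * x t + s = 0"
  have "q + p * x t + s * x t * y t + r * x t * x t * y t = 0" if "t \<in> I" for t
    using bspec[OF h that] xy[OF that] by (simp add: z field_simps)
  then have "poly (poly [:[:q, p:], [:0, s, r:]:] [:y t:]) (x t) = 0" if "t \<in> I" for t
    using that by (auto simp: algebra_simps)
  then have "[:[:q, p:], [:0, s, r:]:] = 0"
    using algebraically_related_onI indep by blast
  then show "p = 0 \<and> q = 0 \<and> r = 0 \<and> s = 0" by simp
qed

section \<open>Curves with constant directions\<close>

text \<open>
  Since \<open>u'\<close> is parallel to \<open>u\<close>, the normalized curve \<open>u / norm u\<close> has derivative zero, so it is a fixed unit vector \<open>w\<close>, and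
  \<open>r\<close> takes only the values \<open>w\<close> and \<open>- w\<close>. Arguing with \<open>u\<close> avoids differentiating \<open>r\<close>, for
  which only continuity is available; continuity is what excludes a change of sign.
\<close>

lemma direction_constant:
  fixes u r :: "real \<Rightarrow> 'a::real_inner"
  assumes I: "open I" "is_interval I"
    and u: "\<And>t. t \<in> I \<Longrightarrow> (u has_vector_derivative f t *\<^sub>R u t) (at t)"
    and ur: "\<And>t. t \<in> I \<Longrightarrow> u t = b t *\<^sub>R r t" and b: "\<And>t. t \<in> I \<Longrightarrow> b t \<noteq> 0"
    and r: "\<And>t. t \<in> I \<Longrightarrow> norm (r t) = 1" and cont: "continuous_on I r"
  shows "r constant_on I"
proof -
  have deriv0: "((\<lambda>s. (1 / sqrt (u s \<bullet> u s)) *\<^sub>R u s) has_vector_derivative 0) (at t)" if t: "t \<in> I" for t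
  proof -
    have "u t \<noteq> 0" using ur[OF t] b[OF t] r[OF t] by auto
    then have pos: "u t \<bullet> u t > 0" by simp
    have "((\<lambda>s. u s \<bullet> u s) has_real_derivative 2 * f t * (u t \<bullet> u t)) (at t)"
      using has_real_derivative_inner[OF u[OF t] u[OF t]] by (simp add: algebra_simps)
    then have "((\<lambda>s. sqrt (u s \<bullet> u s)) has_real_derivative
        inverse (sqrt (u t \<bullet> u t)) / 2 * (2 * f t * (u t \<bullet> u t))) (at t)"
      using pos by (intro DERIV_chain'[where g = sqrt and f = "\<lambda>s. u s \<bullet> u s"] DERIV_real_sqrt)
    also have "inverse (sqrt (u t \<bullet> u t)) / 2 * (2 * f t * (u t \<bullet> u t)) = f t * sqrt (u t \<bullet> u t)"
      using pos real_sqrt_mult_self[of "u t \<bullet> u t"] by (simp add: field_simps)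
    finally have "((\<lambda>s. sqrt (u s \<bullet> u s)) has_real_derivative f t * sqrt (u t \<bullet> u t)) (at t)" .
    from DERIV_divide[OF DERIV_const this, of 1]
    have "((\<lambda>s. 1 / sqrt (u s \<bullet> u s)) has_real_derivative
        - (f t * sqrt (u t \<bullet> u t) / (u t \<bullet> u t))) (at t)"
      using pos by simp
    also have "f t * sqrt (u t \<bullet> u t) / (u t \<bullet> u t) = f t / sqrt (u t \<bullet> u t)"
      using sqrt_divide_self_eq[of "u t \<bullet> u t"] pos
      by (simp add: divide_inverse mult.assoc)
    finally have "((\<lambda>s. 1 / sqrt (u s \<bullet> u s)) has_real_derivative - f t / sqrt (u t \<bullet> u t)) (at t)"
      by simp
    from has_vector_derivative_scaleR[OF this u[OF t]] show ?thesis by simp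
  qed
  have cvx: "convex I"
    using I by (simp add: is_interval_convex)
  obtain w where w: "\<And>t. t \<in> I \<Longrightarrow> (1 / sqrt (u t \<bullet> u t)) *\<^sub>R u t = w"
    using has_vector_derivative_zero_constant[OF cvx has_vector_derivative_at_within[OF deriv0]]
    by metis
  have "r t \<in> {w, - w}" if t: "t \<in> I" for t
  proof -
    have "sqrt (u t \<bullet> u t) = norm (b t *\<^sub>R r t)"
      by (simp only: ur[OF t] norm_eq_sqrt_inner)
    then have "sqrt (u t \<bullet> u t) = \<bar>b t\<bar>"
      using r[OF t] by simp
    then have "w = (b t / \<bar>b t\<bar>) *\<^sub>R r t"
      using w[OF t] ur[OF t] by simp
    then show ?thesis using b[OF t] by (cases "b t > 0") simp_all
  qed
  then have "finite (r ` I)" by (intro finite_subset[of "r ` I" "{w, - w}"]) auto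
  moreover have "connected (r ` I)"
    using I cont by (intro connected_continuous_image) (simp_all add: is_interval_connected)
  ultimately have "r ` I = {} \<or> (\<exists>c. r ` I = {c})"
    using connected_finite_iff_sing by blast
  then show ?thesis unfolding constant_on_def by auto
qed

lemma matrix_mult_vector_3:
  "(M :: real^3^3) *v vector [x, y, z] = x *\<^sub>R column 1 M + y *\<^sub>R column 2 M + z *\<^sub>R column 3 M"
  by (simp add: vec_eq_iff matrix_vector_mult_def column_def sum_3 mult.commute)

lemma column_matrix_mult: "column j (M ** N) = M *v column j N"
  for M :: "real^'n^'m" and N :: "real^'k^'n"
  by (simp add: vec_eq_iff matrix_vector_mult_def matrix_matrix_mult_def column_def)

lemma orthogonal_matrix_expand_3:
  fixes M :: "real^3^3"
  assumes "orthogonal_matrix M"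
  shows "v = (v \<bullet> column 1 M) *\<^sub>R column 1 M + (v \<bullet> column 2 M) *\<^sub>R column 2 M
           + (v \<bullet> column 3 M) *\<^sub>R column 3 M"
proof -
  have "v = M *v (transpose M *v v)"
    using assms
    by (simp add: matrix_vector_mul_assoc orthogonal_matrix_def del: transpose_matrix_vector)
  also have "transpose M *v v = vector [v \<bullet> column 1 M, v \<bullet> column 2 M, v \<bullet> column 3 M]"
    by (simp add: vec_eq_iff forall_3 vector_3 matrix_vector_mult_def transpose_def
        column_def inner_vec_def sum_3 mult.commute del: transpose_matrix_vector)
  finally show ?thesis by (simp add: matrix_mult_vector_3)
qed

lemma derivative_orthogonal:
  assumes I: "open I" "t \<in> I"
    and u: "(u has_vector_derivative u') (at t)" and v: "(v has_vector_derivative v') (at t)"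
    and orth: "\<And>s. s \<in> I \<Longrightarrow> u s \<bullet> v s = 0"
  shows "u t \<bullet> v' + u' \<bullet> v t = 0"
proof -
  have "((\<lambda>s. 0) has_real_derivative (u t \<bullet> v' + u' \<bullet> v t)) (at t)"
    using has_field_derivative_transform_within_open[OF has_real_derivative_inner[OF u v] I]
    by (simp add: orth)
  then show ?thesis using DERIV_unique DERIV_const by blast
qed

text \<open>
  The bracket gives the difference, and \<open>u \<bullet> v = 0\<close> the sum, of \<open>u' \<bullet> v\<close> and \<open>v' \<bullet> u\<close>.
\<close>

lemma derivative_orthogonal_skew:
  assumes I: "open I" "t \<in> I"
    and u: "(u has_vector_derivative u') (at t)" and v: "(v has_vector_derivative v') (at t)"
    and orth: "\<And>s. s \<in> I \<Longrightarrow> u s \<bullet> v s = 0" and sk: "skew u v t = 0"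
  shows "u' \<bullet> v t = 0" "v' \<bullet> u t = 0"
  using derivative_orthogonal[OF I u v orth] sk
  unfolding skew_def vector_derivative_at[OF u] vector_derivative_at[OF v]
  by (simp_all add: inner_commute)

text \<open>
  The derivative of \<open>u\<close> is orthogonal to \<open>q\<close> because \<open>u\<close> is, whether or not the factor \<open>f\<close> is
  differentiable.
\<close>

lemma skew_orthogonal_directions:
  assumes I: "open I" "t \<in> I"
    and u: "(u has_vector_derivative u') (at t)" and v: "(v has_vector_derivative v') (at t)"
    and up: "\<And>s. s \<in> I \<Longrightarrow> u s = f s *\<^sub>R p" and vq: "\<And>s. s \<in> I \<Longrightarrow> v s = g s *\<^sub>R q"
    and pq: "p \<bullet> q = 0"
  shows "skew u v t = 0"
proof -
  have "u' \<bullet> q = 0"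
    using derivative_orthogonal[OF I u has_vector_derivative_const, of q] by (simp add: up pq)
  moreover have "v' \<bullet> p = 0"
    using derivative_orthogonal[OF I v has_vector_derivative_const, of p]
    by (simp add: vq pq inner_commute)
  ultimately show ?thesis
    unfolding skew_def vector_derivative_at[OF u] vector_derivative_at[OF v]
    by (simp add: up vq I)
qed

section \<open>Classification of the time components\<close>

theorem theorem6p3:
  fixes I :: "real set"
    and A :: "real \<Rightarrow> real^6^3"
    and R :: "real \<Rightarrow> real^3^3"
    and b11 b12 b13 b22 b23 l1 l2 :: "real \<Rightarrow> real"
  assumes I: "open I" "is_interval I" "I \<noteq> {}"
    and A_smooth: "smooth_on I A"
    and A_eq: "\<And>t. t \<in> I \<Longrightarrow>
          A t = R t ** B_matrix (b11 t) (b12 t) (b13 t) (b22 t) (b23 t) (l1 t) (l2 t)"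
    and R_rot: "\<And>t. t \<in> I \<Longrightarrow> rotation_matrix (R t)"
    and R_cont: "continuous_on I R"
    and nonzero: "\<And>t. t \<in> I \<Longrightarrow> b11 t \<noteq> 0 \<and> b22 t \<noteq> 0 \<and> l1 t \<noteq> 0 \<and> l2 t \<noteq> 0"
    and indep: "columns_independent_on I A"
  shows
    "(\<forall>c :: 6 \<Rightarrow> 6 \<Rightarrow> real.
        (\<forall>(i, j)\<in>listed_pairs. \<forall>t\<in>I. Q A i j t = c i j) \<and>
        \<not> algebraically_related_on I l1 l2 \<longrightarrow>
        R constant_on I \<and>
        (\<forall>t\<in>I.
           (l1 has_real_derivative - c 1 6 / (b11 t)^2) (at t) \<and>
           (l2 has_real_derivative - c 2 4 / (b22 t)^2) (at t) \<and>
           c 3 5 * (l1 t)^2 * (l2 t)^2 * (b11 t)^4 * (b22 t)^4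
             + c 1 6 * (b22 t)^2 * l2 t + c 2 4 * (b11 t)^2 * l1 t = 0 \<and>
           b12 t = 0 \<and> b13 t = 0 \<and> b23 t = 0))
     \<and>
     (\<forall>c16 c24 c35 :: real.
        R constant_on I \<and>
        (\<forall>t\<in>I.
           (l1 has_real_derivative - c16 / (b11 t)^2) (at t) \<and>
           (l2 has_real_derivative - c24 / (b22 t)^2) (at t) \<and>
           c35 * (l1 t)^2 * (l2 t)^2 * (b11 t)^4 * (b22 t)^4
             + c16 * (b22 t)^2 * l2 t + c24 * (b11 t)^2 * l1 t = 0 \<and>
           b12 t = 0 \<and> b13 t = 0 \<and> b23 t = 0) \<longrightarrow>
        (\<forall>(i, j)\<in>listed_pairs. Q A i j constant_on I))"
proof -
  define a where "a j = (\<lambda>s. column j (A s))" for j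
  define a' where "a' j t = vector_derivative (a j) (at t)" for j t
  define l3 where "l3 = (\<lambda>s. 1 / (l1 s * l2 s))"
  have Q_skew: "Q A i j t = skew (a i) (a j) t" for i j t
    by (simp add: Q_eq_skew a_def)
  have orth: "orthogonal_matrix (R t)" if "t \<in> I" for t
    using R_rot[OF that] by (simp add: rotation_matrix_def)
  have unit: "norm (column i (R t)) = 1" if "t \<in> I" for i t
    using orth[OF that] by (simp add: orthogonal_matrix_orthonormal_columns)
  have unit_inner: "column i (R t) \<bullet> column i (R t) = 1" if "t \<in> I" for i t
    using unit[OF that, of i] by (simp add: norm_eq_1)
  have perp: "column i (R t) \<bullet> column j (R t) = 0" if "t \<in> I" "i \<noteq> j" for i j t
    using orth[OF that(1)] that(2)
    by (simp add: orthogonal_matrix_orthonormal_columns orthogonal_def)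
  have a: "(a j has_vector_derivative a' j t) (at t)" if "t \<in> I" for j t
  proof -
    have "A differentiable_on I"
      using A_smooth[unfolded smooth_on_def, rule_format, of 0] by simp
    then have "A differentiable (at t)"
      using I(1) that by (simp add: differentiable_on_eq_differentiable_at)
    then have "(A has_vector_derivative vector_derivative A (at t)) (at t)"
      by (simp add: vector_derivative_works)
    moreover have "bounded_linear (column j :: real^6^3 \<Rightarrow> real^3)"
      unfolding linear_conv_bounded_linear[symmetric]
      by (rule linearI) (simp_all add: column_def vec_eq_iff)
    ultimately have "(a j has_vector_derivative column j (vector_derivative A (at t))) (at t)"
      unfolding a_def by (rule bounded_linear.has_vector_derivative[rotated])
    with vector_derivative_at[OF this] show ?thesis
      by (simp add: a'_def)
  qed
  have col:
    "a 1 t = b11 t *\<^sub>R column 1 (R t)"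
    "a 2 t = b12 t *\<^sub>R column 1 (R t) + b22 t *\<^sub>R column 2 (R t)"
    "a 3 t = b13 t *\<^sub>R column 1 (R t) + b23 t *\<^sub>R column 2 (R t)
           + (1 / (b11 t * b22 t)) *\<^sub>R column 3 (R t)"
    "a 4 t = l2 t *\<^sub>R a 2 t" "a 5 t = l3 t *\<^sub>R a 3 t" "a 6 t = l1 t *\<^sub>R a 1 t"
    if "t \<in> I" for t
    unfolding a_def A_eq[OF that] column_matrix_mult B_matrix_columns matrix_mult_vector_3 l3_def
    by (simp_all add: scaleR_add_right)
  have gram:
    "a 1 t \<bullet> a 1 t = (b11 t)^2"
    "a 1 t \<bullet> a 2 t = b11 t * b12 t" "a 1 t \<bullet> a 3 t = b11 t * b13 t"
    "a 2 t \<bullet> a 3 t = b12 t * b13 t + b22 t * b23 t"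
    "a 2 t \<bullet> a 2 t = (b12 t)^2 + (b22 t)^2"
    "a 3 t \<bullet> a 3 t = (b13 t)^2 + (b23 t)^2 + (1 / (b11 t * b22 t))^2"
    if "t \<in> I" for t
    using that unfolding col[OF that]
    by (simp_all add: inner_add_left inner_add_right perp unit_inner power2_eq_square)
  have ne0: "a 1 t \<noteq> 0" "a 2 t \<noteq> 0" "a 3 t \<noteq> 0" if "t \<in> I" for t
  proof -
    have "a 1 t \<bullet> a 1 t > 0" "a 2 t \<bullet> a 2 t > 0" "a 3 t \<bullet> a 3 t > 0"
      unfolding gram[OF that] using nonzero[OF that]
      by (simp_all add: add_nonneg_pos)
    then show "a 1 t \<noteq> 0" "a 2 t \<noteq> 0" "a 3 t \<noteq> 0" by auto
  qed
  have ln0: "l1 t \<noteq> 0" "l2 t \<noteq> 0" "l3 t \<noteq> 0" if "t \<in> I" for t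
    using nonzero[OF that] by (simp_all add: l3_def)
  have dl1: "(l1 has_real_derivative deriv l1 t) (at t)" if "t \<in> I" for t
    using multiplier_differentiable[OF I(1) that a[OF that] a[OF that] col(6) ne0(1)]
    by (metis DERIV_imp_deriv)
  have dl2: "(l2 has_real_derivative deriv l2 t) (at t)" if "t \<in> I" for t
    using multiplier_differentiable[OF I(1) that a[OF that] a[OF that] col(4) ne0(2)]
    by (metis DERIV_imp_deriv)
  define l3' where "l3' t = - (deriv l1 t * l2 t + l1 t * deriv l2 t) / (l1 t * l2 t)^2" for t
  have dl3: "(l3 has_real_derivative l3' t) (at t)" if "t \<in> I" for t
    unfolding l3_def l3'_def using ln0(1,2)[OF that]
    by (auto intro!: derivative_eq_intros dl1[OF that] dl2[OF that] simp: power2_eq_square field_simps)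
  (* The signs at (4, 5) and (5, 6) come from listing each pair in the cyclic order of the columns. *)
  have Q_scaled:
    "Q A 1 6 t = skew (a 1) (\<lambda>s. l1 s *\<^sub>R a 1 s) t"
    "Q A 2 4 t = skew (a 2) (\<lambda>s. l2 s *\<^sub>R a 2 s) t"
    "Q A 3 5 t = skew (a 3) (\<lambda>s. l3 s *\<^sub>R a 3 s) t"
    "Q A 2 6 t = skew (a 2) (\<lambda>s. l1 s *\<^sub>R a 1 s) t"
    "Q A 4 6 t = skew (\<lambda>s. l2 s *\<^sub>R a 2 s) (\<lambda>s. l1 s *\<^sub>R a 1 s) t"
    "Q A 3 4 t = skew (a 3) (\<lambda>s. l2 s *\<^sub>R a 2 s) t"
    "- Q A 4 5 t = skew (\<lambda>s. l3 s *\<^sub>R a 3 s) (\<lambda>s. l2 s *\<^sub>R a 2 s) t"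
    "Q A 1 5 t = skew (a 1) (\<lambda>s. l3 s *\<^sub>R a 3 s) t"
    "- Q A 5 6 t = skew (\<lambda>s. l1 s *\<^sub>R a 1 s) (\<lambda>s. l3 s *\<^sub>R a 3 s) t"
    if "t \<in> I" for t
    unfolding Q_skew skew_swap[of _ "a 4", symmetric] skew_swap[of _ "a 5", symmetric]
    by (intro skew_cong[OF I(1) that] refl; simp only: col)+
  have Q_parallel:
    "Q A 1 6 t = - deriv l1 t * (a 1 t \<bullet> a 1 t)"
    "Q A 2 4 t = - deriv l2 t * (a 2 t \<bullet> a 2 t)"
    "Q A 3 5 t = - l3' t * (a 3 t \<bullet> a 3 t)" if "t \<in> I" for t
    unfolding Q_scaled[OF that] skew_scaleR_right[OF a[OF that] a[OF that] dl1[OF that]]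
      skew_scaleR_right[OF a[OF that] a[OF that] dl2[OF that]]
      skew_scaleR_right[OF a[OF that] a[OF that] dl3[OF that]] by simp_all
  show ?thesis
  proof (intro conjI allI impI ballI; elim conjE)
    fix c :: "6 \<Rightarrow> 6 \<Rightarrow> real"
    assume H: "\<forall>(i, j)\<in>listed_pairs. \<forall>t\<in>I. Q A i j t = c i j"
      and unrelated: "\<not> algebraically_related_on I l1 l2"
    have Qc: "Q A i j t = c i j" if "(i, j) \<in> listed_pairs" "t \<in> I" for i j t
      using H that by auto
    note lp = listed_pairs_def
    have l1'0: "deriv l1 t \<noteq> 0" if "t \<in> I" for t
    proof (rule multiplier_constant_or_regular[OF I(1,2) a[of _ 1] dl1 ne0(1)])
      show "skew (a 1) (\<lambda>s. l1 s *\<^sub>R a 1 s) t = c 1 6" if "t \<in> I" for t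
        using Qc[of 1 6, OF _ that] Q_scaled(1)[OF that] by (simp add: lp)
    qed (use algebraically_related_if_constant(1) unrelated that in blast)+
    have l2'0: "deriv l2 t \<noteq> 0" if "t \<in> I" for t
    proof (rule multiplier_constant_or_regular[OF I(1,2) a[of _ 2] dl2 ne0(2)])
      show "skew (a 2) (\<lambda>s. l2 s *\<^sub>R a 2 s) t = c 2 4" if "t \<in> I" for t
        using Qc[of 2 4, OF _ that] Q_scaled(2)[OF that] by (simp add: lp)
    qed (use algebraically_related_if_constant(2) unrelated that in blast)+
    have xy: "l1 t \<noteq> 0 \<and> l2 t \<noteq> 0" if "t \<in> I" for t using nonzero[OF that] by blast
    note indep3 = no_bilinear_relation[OF unrelated xy l3_def]
    have p12: "c 1 2 = 0 \<and> (\<forall>t\<in>I. deriv l1 t * (a 1 t \<bullet> a 2 t) = 0 \<and> deriv l2 t * (a 1 t \<bullet> a 2 t) = 0)"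
    proof (rule multiplier_pair[OF I(1,2) a a dl1 dl2 ln0(1) _ _ _ indep3(1)])
      show "skew (a 1) (a 2) t = c 1 2" if "t \<in> I" for t
        using Qc[of 1 2, OF _ that] by (simp add: lp Q_skew)
      show "skew (a 2) (\<lambda>s. l1 s *\<^sub>R a 1 s) t = c 2 6" if "t \<in> I" for t
        using Qc[of 2 6, OF _ that] Q_scaled(4)[OF that] by (simp add: lp)
      show "skew (\<lambda>s. l2 s *\<^sub>R a 2 s) (\<lambda>s. l1 s *\<^sub>R a 1 s) t = c 4 6" if "t \<in> I" for t
        using Qc[of 4 6, OF _ that] Q_scaled(5)[OF that] by (simp add: lp)
    qed
    have p23: "c 2 3 = 0 \<and> (\<forall>t\<in>I. deriv l2 t * (a 2 t \<bullet> a 3 t) = 0 \<and> l3' t * (a 2 t \<bullet> a 3 t) = 0)"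
    proof (rule multiplier_pair[OF I(1,2) a a dl2 dl3 ln0(2) _ _ _ indep3(2)])
      show "skew (a 2) (a 3) t = c 2 3" if "t \<in> I" for t
        using Qc[of 2 3, OF _ that] by (simp add: lp Q_skew)
      show "skew (a 3) (\<lambda>s. l2 s *\<^sub>R a 2 s) t = c 3 4" if "t \<in> I" for t
        using Qc[of 3 4, OF _ that] Q_scaled(6)[OF that] by (simp add: lp)
      show "skew (\<lambda>s. l3 s *\<^sub>R a 3 s) (\<lambda>s. l2 s *\<^sub>R a 2 s) t = - c 4 5" if "t \<in> I" for t
        using Qc[of 4 5, OF _ that] Q_scaled(7)[OF that] by (simp add: lp)
    qed
    have p31: "- c 1 3 = 0 \<and> (\<forall>t\<in>I. l3' t * (a 3 t \<bullet> a 1 t) = 0 \<and> deriv l1 t * (a 3 t \<bullet> a 1 t) = 0)"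
    proof (rule multiplier_pair[OF I(1,2) a a dl3 dl1 ln0(3) _ _ _ indep3(3)])
      show "skew (a 3) (a 1) t = - c 1 3" if "t \<in> I" for t
        using Qc[of 1 3, OF _ that] skew_swap[of "a 3" "a 1"] by (simp add: lp Q_skew)
      show "skew (a 1) (\<lambda>s. l3 s *\<^sub>R a 3 s) t = c 1 5" if "t \<in> I" for t
        using Qc[of 1 5, OF _ that] Q_scaled(8)[OF that] by (simp add: lp)
      show "skew (\<lambda>s. l1 s *\<^sub>R a 1 s) (\<lambda>s. l3 s *\<^sub>R a 3 s) t = - c 5 6" if "t \<in> I" for t
        using Qc[of 5 6, OF _ that] Q_scaled(9)[OF that] by (simp add: lp)
    qed
    have perp_a: "a 1 t \<bullet> a 2 t = 0" "a 1 t \<bullet> a 3 t = 0" "a 2 t \<bullet> a 3 t = 0" if "t \<in> I" for t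
      using p12 p23 p31 l1'0[OF that] l2'0[OF that] that by (auto simp: inner_commute)
    have diag: "b12 t = 0" "b13 t = 0" "b23 t = 0" if "t \<in> I" for t
      using perp_a[OF that] gram(2-4)[OF that] nonzero[OF that] by auto
    define d :: "3 \<Rightarrow> real \<Rightarrow> real"
      where "d i t = (if i = 1 then b11 t else if i = 2 then b22 t else 1 / (b11 t * b22 t))" for i t
    define e :: "3 \<Rightarrow> real \<Rightarrow> real^3"
      where "e i = (if i = 1 then a 1 else if i = 2 then a 2 else a 3)" for i
    define e' :: "3 \<Rightarrow> real \<Rightarrow> real^3"
      where "e' i = (if i = 1 then a' 1 else if i = 2 then a' 2 else a' 3)" for i
    have e: "e i t = d i t *\<^sub>R column i (R t)" and d0: "d i t \<noteq> 0" if "t \<in> I" for i t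
      using exhaust_3[of i] col(1-3)[OF that] diag[OF that] nonzero[OF that]
      by (auto simp: e_def d_def)
    have de: "(e i has_vector_derivative e' i t) (at t)" if "t \<in> I" for i t
      using a[OF that] by (simp add: e_def e'_def)
    (* Both the inner product and the bracket of two different curves e i, e j vanish. *)
    have perp_e': "e' i t \<bullet> column j (R t) = 0" if "t \<in> I" "i \<noteq> j" for i j t
    proof -
      have sk: "skew (e i) (e j) t = 0"
        using that(2) p12 p23 p31 Qc[of 1 2, OF _ that(1)] Qc[of 1 3, OF _ that(1)]
          Qc[of 2 3, OF _ that(1)] skew_swap[of "a 2" "a 1"] skew_swap[of "a 3" "a 1"]
          skew_swap[of "a 3" "a 2"] exhaust_3[of i] exhaust_3[of j]
        by (auto simp: e_def lp Q_skew)
      have "e' i t \<bullet> e j t = 0"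
        by (rule derivative_orthogonal_skew(1)[OF I(1) that(1) de de _ sk])
           (use that e perp in auto)
      then show ?thesis using e d0 that(1) by simp
    qed
    have "(\<lambda>t. column i (R t)) constant_on I" for i
    proof (rule direction_constant[OF I(1,2) _ e d0 unit])
      show "(e i has_vector_derivative ((e' i t \<bullet> column i (R t)) / d i t) *\<^sub>R e i t) (at t)"
        if "t \<in> I" for t
      proof -
        have "e' i t = (e' i t \<bullet> column i (R t)) *\<^sub>R column i (R t)"
          using orthogonal_matrix_expand_3[OF orth[OF that], of "e' i t"]
            perp_e'[OF that, of i] exhaust_3[of i] by auto
        then show ?thesis using de[OF that, of i] e[OF that, of i] d0[OF that, of i] by simp
      qed
      show "continuous_on I (\<lambda>t. column i (R t))"
        unfolding column_def using R_cont by (intro continuous_intros)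
    qed
    then obtain w where w: "\<And>i t. t \<in> I \<Longrightarrow> column i (R t) = w i"
      unfolding constant_on_def by metis
    have "R t = (\<chi> i j. w j $ i)" if "t \<in> I" for t
      using w[OF that] by (simp add: vec_eq_iff column_def)
    then show "R constant_on I" unfolding constant_on_def by blast
    fix t assume t: "t \<in> I"
    show "b12 t = 0" "b13 t = 0" "b23 t = 0" using diag[OF t] by blast+
    note nz = nonzero[OF t]
    have l1': "deriv l1 t = - c 1 6 / (b11 t)^2"
      using Q_parallel(1)[OF t] Qc[of 1 6, OF _ t] nz by (simp add: lp gram t field_simps)
    have l2': "deriv l2 t = - c 2 4 / (b22 t)^2"
      using Q_parallel(2)[OF t] Qc[of 2 4, OF _ t] nz by (simp add: lp gram t diag field_simps)
    show "(l1 has_real_derivative - c 1 6 / (b11 t)^2) (at t)"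
      "(l2 has_real_derivative - c 2 4 / (b22 t)^2) (at t)"
      using dl1[OF t] dl2[OF t] l1' l2' by simp_all
    have "- l3' t * (1 / (b11 t * b22 t))^2 = c 3 5"
      using Q_parallel(3)[OF t] Qc[of 3 5, OF _ t] by (simp add: lp gram t diag)
    then show "c 3 5 * (l1 t)^2 * (l2 t)^2 * (b11 t)^4 * (b22 t)^4
         + c 1 6 * (b22 t)^2 * l2 t + c 2 4 * (b11 t)^2 * l1 t = 0"
      unfolding l3'_def l1' l2' using nz by (simp add: field_simps)
  next
    fix c16 c24 c35 :: real
    assume Rc: "R constant_on I"
      and H: "\<forall>t\<in>I.
           (l1 has_real_derivative - c16 / (b11 t)^2) (at t) \<and>
           (l2 has_real_derivative - c24 / (b22 t)^2) (at t) \<and>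
           c35 * (l1 t)^2 * (l2 t)^2 * (b11 t)^4 * (b22 t)^4
             + c16 * (b22 t)^2 * l2 t + c24 * (b11 t)^2 * l1 t = 0 \<and>
           b12 t = 0 \<and> b13 t = 0 \<and> b23 t = 0"
    from Rc obtain R0 where R0: "\<And>t. t \<in> I \<Longrightarrow> R t = R0" by (auto simp: constant_on_def)
    have diag: "b12 t = 0" "b13 t = 0" "b23 t = 0" if "t \<in> I" for t using H that by auto
    have dir: "a 1 t = b11 t *\<^sub>R column 1 R0" "a 2 t = b22 t *\<^sub>R column 2 R0"
      "a 3 t = (1 / (b11 t * b22 t)) *\<^sub>R column 3 R0"
      "a 4 t = (l2 t * b22 t) *\<^sub>R column 2 R0"
      "a 5 t = (l3 t * (1 / (b11 t * b22 t))) *\<^sub>R column 3 R0"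
      "a 6 t = (l1 t * b11 t) *\<^sub>R column 1 R0" if "t \<in> I" for t
      using col[OF that] diag[OF that] R0[OF that] by simp_all
    have perp0: "column i R0 \<bullet> column j R0 = 0" if "i \<noteq> j" for i j
      using perp[OF _ that] R0 I(3) by fastforce
    have const: "Q A i j constant_on I" if "\<And>t. t \<in> I \<Longrightarrow> Q A i j t = k" for i j k
      using that unfolding constant_on_def by blast
    have orthQ: "Q A i j constant_on I"
      if "\<And>s. s \<in> I \<Longrightarrow> a i s = f s *\<^sub>R column m R0"
        "\<And>s. s \<in> I \<Longrightarrow> a j s = g s *\<^sub>R column n R0" "m \<noteq> n" for i j m n f g
      by (rule const[of _ _ 0])
         (simp only: Q_skew, rule skew_orthogonal_directions[OF I(1) _ a a that(1,2) perp0[OF that(3)]])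
    have zeros: "Q A 1 2 constant_on I" "Q A 1 3 constant_on I" "Q A 1 5 constant_on I"
      "Q A 2 3 constant_on I" "Q A 2 6 constant_on I" "Q A 3 4 constant_on I"
      "Q A 4 5 constant_on I" "Q A 4 6 constant_on I" "Q A 5 6 constant_on I"
      using orthQ[OF dir(1) dir(2)] orthQ[OF dir(1) dir(3)] orthQ[OF dir(1) dir(5)]
        orthQ[OF dir(2) dir(3)] orthQ[OF dir(2) dir(6)] orthQ[OF dir(3) dir(4)]
        orthQ[OF dir(4) dir(5)] orthQ[OF dir(4) dir(6)] orthQ[OF dir(5) dir(6)]
      by simp_all
    have l': "deriv l1 t = - c16 / (b11 t)^2" "deriv l2 t = - c24 / (b22 t)^2" if "t \<in> I" for t
      using H that by (auto intro: DERIV_imp_deriv)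
    have "Q A 1 6 constant_on I"
      by (rule const[of _ _ c16]) (use nonzero in \<open>simp add: Q_parallel gram l'\<close>)
    moreover have "Q A 2 4 constant_on I"
      by (rule const[of _ _ c24]) (use nonzero in \<open>simp add: Q_parallel gram l' diag\<close>)
    moreover have "Q A 3 5 constant_on I"
    proof (rule const[of _ _ c35])
      fix t assume t: "t \<in> I"
      have "c35 * (l1 t)^2 * (l2 t)^2 * (b11 t)^4 * (b22 t)^4
             + c16 * (b22 t)^2 * l2 t + c24 * (b11 t)^2 * l1 t = 0" using H t by blast
      then show "Q A 3 5 t = c35"
        using nonzero[OF t] by (simp add: Q_parallel gram diag l3'_def l' t field_simps)
    qed
    ultimately show "case ij of (i, j) \<Rightarrow> Q A i j constant_on I" if "ij \<in> listed_pairs" for ij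
      using zeros that by (auto simp: listed_pairs_def)
  qed
qed

end
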